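(* Let $T$ be a random vector with values in $\mathcal{T}\subseteq\mathbb{R}^d$, let $0<\alpha\le\beta$, and let $U:\mathcal{T}\times\mathbb{R}^r\to\mathbb{R}$ be a utility, twice differentiable in its second argument, with oracle action $\phi^*:\mathcal{T}\to\mathbb{R}^r$, such that for every $t\in\mathcal{T}$: (A0) $\phi^*(t)$ is an unconstrained maximizer of $a\mapsto U(t,a)$ on $\mathbb{R}^r$ (hence $\nabla_a U(t,\phi^*(t))=0$); (A1) $\nabla^2_{aa}U(t,a)\succeq-\beta I$ for all $a\in\mathbb{R}^r$; (A2) $\nabla^2_{aa}U(t,a)\preceq-\alpha I$ for all $a\in\mathbb{R}^r$. Let $\ell(t,a)=U(t,\phi^*(t))-U(t,a)$. Then every reproduction action $\hat A$ (an $\mathbb{R}^r$-valued random vector defined jointly with $T$) satisfies $$\frac{\alpha}{2}\,\mathbb{E}\|\phi^*(T)-\hat A\|^2\;\le\;\mathbb{E}\,\ell(T,\hat A)\;\le\;\frac{\beta}{2}\,\mathbb{E}\|\phi^*(T)-\hat A\|^2 .$$ Moreover, if $U(t,a)=u(t)-\frac{\gamma}{2}\|a-\phi^*(t)\|^2$ for some function $u:\mathcal{T}\to\mathbb{R}$ and some $\gamma>0$, then both inequalities are equalities with $\alpha=\beta=\gamma$.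
   Context: $\|\cdot\|$ is the Euclidean norm, $I$ the $r\times r$ identity, $\succeq,\preceq$ the Loewner order on symmetric matrices, and $\nabla_a,\nabla^2_{aa}$ the gradient and Hessian in the action variable $a$. All functions ($U$, $\phi^*$) are assumed measurable so that the expectations make sense; since $\ell\ge0$, expectations take values in $[0,\infty]$. *)

theory Defs
  imports "HOL-Probability.Probability"
begin

definition gradient :: "('a::real_inner \<Rightarrow> real) \<Rightarrow> 'a \<Rightarrow> 'a"
  where "gradient f a = (THE g. GDERIV f a :> g)"

definition hessian :: "(real^'r \<Rightarrow> real) \<Rightarrow> real^'r \<Rightarrow> real^'r^'r"
  where "hessian f a = jacobian (gradient f) (at a)"

definition twice_differentiable :: "('a::real_inner \<Rightarrow> real) \<Rightarrow> bool"
  where "twice_differentiable f \<longleftrightarrow>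
    (\<forall>a. f differentiable (at a)) \<and> (\<forall>a. gradient f differentiable (at a))"

text \<open>
  The Loewner order is the order on symmetric matrices for which \<open>B - A\<close> is positive
  semidefinite. Symmetry is not demanded here: the order is only applied to multiples of the
  identity and to Hessians of twice Frechet differentiable functions, and these are symmetric
  by Schwarz' theorem.
\<close>
definition loewner_le :: "real^'r^'r \<Rightarrow> real^'r^'r \<Rightarrow> bool" (infix "\<preceq>" 50)
  where "A \<preceq> B \<longleftrightarrow> (\<forall>x. 0 \<le> x \<bullet> ((B - A) *v x))"

text \<open>
  Functions on \<open>\<T>\<close> are total functions on \<open>real^'d\<close> whose values outside \<open>\<T>\<close> are irrelevant.
  The optimality of \<open>\<phi> t\<close> is global over the whole action space.
\<close>
definition regular_utility ::
  "(real^'d) set \<Rightarrow> (real^'d \<Rightarrow> real^'r \<Rightarrow> real) \<Rightarrow> (real^'d \<Rightarrow> real^'r) \<Rightarrow> real \<Rightarrow> real \<Rightarrow> bool"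
  where "regular_utility \<T> U \<phi> \<alpha> \<beta> \<longleftrightarrow>
    (\<forall>t\<in>\<T>. twice_differentiable (U t)
      \<and> (\<forall>a. U t a \<le> U t (\<phi> t))
      \<and> (\<forall>a. (- \<beta>) *\<^sub>R mat 1 \<preceq> hessian (U t) a)
      \<and> (\<forall>a. hessian (U t) a \<preceq> (- \<alpha>) *\<^sub>R mat 1))"

definition loss ::
  "(real^'d \<Rightarrow> real^'r \<Rightarrow> real) \<Rightarrow> (real^'d \<Rightarrow> real^'r) \<Rightarrow> real^'d \<Rightarrow> real^'r \<Rightarrow> real"
  where "loss U \<phi> t a = U t (\<phi> t) - U t a"

text \<open>
  Expectation with values in \<open>[0,\<infinity>]\<close>. It is used for nonnegative \<open>X\<close> only, so the truncation
  of negative values by \<open>ennreal\<close> plays no role; the loss is nonnegative because \<open>\<phi> t\<close> is a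
  maximizer.
\<close>
definition ext_expectation :: "'w measure \<Rightarrow> ('w \<Rightarrow> real) \<Rightarrow> ennreal"
  where "ext_expectation M X = (\<integral>\<^sup>+ \<omega>. ennreal (X \<omega>) \<partial>M)"

end

theory Submission
  imports Defs
begin

text \<open>
  Along the segment from the maximizer \<open>\<phi> t\<close> to \<open>a\<close>, Taylor's formula has no linear term and its
  Lagrange remainder is a Hessian quadratic form at an intermediate point. The two Loewner bounds
  therefore sandwich the loss pointwise between \<open>\<alpha>/2\<close> and \<open>\<beta>/2\<close> times the squared distance, and
  integration preserves this.
\<close>

text \<open>Frechet derivatives are unique and a vector is determined by its inner products. So the
  description in \<open>gradient\<close> can be evaluated from any known derivative.\<close>

lemma gradient_eqI:
  assumes "GDERIV f a :> g"
  shows "gradient f a = g"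
  unfolding gradient_def
proof (rule the_equality)
  fix h assume "GDERIV f a :> h"
  then have "(\<lambda>x. x \<bullet> h) = (\<lambda>x. x \<bullet> g)"
    using assms unfolding gderiv_def by (rule has_derivative_unique)
  then show "h = g"
    by (metis inner_commute vector_eq_ldot)
qed (fact assms)

text \<open>Riesz representation in finite dimension: for a linear functional \<open>D\<close>, the
  vector is \<open>adjoint D 1\<close>, because \<open>D h = D h * 1\<close> and the adjoint moves
  \<open>D\<close> to the other side of the inner product.\<close>

lemma GDERIV_gradient:
  fixes f :: "'a::euclidean_space \<Rightarrow> real"
  assumes "f differentiable (at a)"
  shows "GDERIV f a :> gradient f a"
proof -
  obtain D where D: "(f has_derivative D) (at a)"
    using assms unfolding differentiable_def by blast
  have "linear D"
    using D by (rule has_derivative_linear)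
  then have "D = (\<lambda>h. h \<bullet> adjoint D 1)"
    by (simp add: adjoint_works fun_eq_iff)
  with D have "GDERIV f a :> adjoint D 1"
    unfolding gderiv_def by simp
  then show ?thesis
    using gradient_eqI by metis
qed

lemma gradient_eq_0_at_max:
  fixes f :: "'a::euclidean_space \<Rightarrow> real"
  assumes "f differentiable (at p)" and "\<And>a. f a \<le> f p"
  shows "gradient f p = 0"
proof -
  have "(\<lambda>h. h \<bullet> gradient f p) = (\<lambda>h. 0)"
    using GDERIV_gradient[OF assms(1)] assms(2) unfolding gderiv_def
    by (intro differential_zero_maxmin[of p UNIV f]) auto
  \<comment> \<open>Evaluating the zero functional at the gradient itself makes its squared norm
    vanish.\<close>
  then show ?thesis
    by (metis inner_eq_zero_iff)
qed

lemma has_derivative_gradient_hessian: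
  fixes f :: "real^'r \<Rightarrow> real"
  assumes "gradient f differentiable (at a)"
  shows "(gradient f has_derivative (\<lambda>h. hessian f a *v h)) (at a)"
  using assms unfolding hessian_def jacobian_works .

lemma hessian_eqI:
  fixes f :: "real^'r \<Rightarrow> real"
  assumes "(gradient f has_derivative (\<lambda>h. H *v h)) (at a)"
  shows "hessian f a = H"
  unfolding hessian_def jacobian_def frechet_derivative_at[OF assms, symmetric]
  by simp

text \<open>Reduction to one variable: restrict \<open>f\<close> to the line through
  \<open>p\<close> and \<open>a\<close>. The Lagrange form of the remainder suits
  \<open>twice_differentiable\<close>, since it asks for existence of the second derivative and not
  for its continuity.\<close>

lemma taylor_second_order:
  fixes f :: "real^'r \<Rightarrow> real"
  assumes "twice_differentiable f"
  obtains \<xi> where "f a = f p + (a - p) \<bullet> gradient f p + (a - p) \<bullet> (hessian f \<xi> *v (a - p)) / 2"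
proof -
  define v where "v = a - p"
  \<comment> \<open>\<open>Maclaurin\<close> expects the successive derivatives as a family indexed
    by naturals; only the indices 0, 1 and 2 are consulted.\<close>
  define D where "D = (\<lambda>m::nat. if m = 0 then (\<lambda>s::real. f (p + s *\<^sub>R v))
    else if m = 1 then (\<lambda>s. v \<bullet> gradient f (p + s *\<^sub>R v))
    else (\<lambda>s. v \<bullet> (hessian f (p + s *\<^sub>R v) *v v)))"
  have line: "((\<lambda>s. p + s *\<^sub>R v) has_derivative (\<lambda>h. h *\<^sub>R v)) (at s)" for s
    by (auto intro!: derivative_eq_intros)
  have D0: "(D 0 has_real_derivative D 1 s) (at s)" for s
  proof -
    have "(f has_derivative (\<lambda>h. h \<bullet> gradient f (p + s *\<^sub>R v))) (at (p + s *\<^sub>R v))"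
      using GDERIV_gradient assms unfolding twice_differentiable_def gderiv_def by blast
    from has_derivative_compose[OF line this] show ?thesis
      by (simp add: D_def has_field_derivative_def mult_commute_abs inner_commute[of v])
  qed
  have D1: "(D 1 has_real_derivative D 2 s) (at s)" for s
  proof -
    have "(gradient f has_derivative (\<lambda>h. hessian f (p + s *\<^sub>R v) *v h)) (at (p + s *\<^sub>R v))"
      using has_derivative_gradient_hessian assms unfolding twice_differentiable_def by blast
    from has_derivative_inner_right[OF has_derivative_compose[OF line this], of v] show ?thesis
      by (simp add: D_def has_field_derivative_def matrix_vector_mult_scaleR mult_commute_abs)
  qed
  have "\<forall>m s. m < 2 \<and> 0 \<le> s \<and> s \<le> 1 \<longrightarrow> DERIV (D m) s :> D (Suc m) s"
    using D0 D1 by (auto simp: numeral_2_eq_2 less_Suc_eq)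
  \<comment> \<open>Expansion of order 2 at parameter 1, where the line reaches \<open>a\<close>;
    the intermediate parameter \<open>s\<close> yields the point \<open>p + s *\<^sub>R v\<close>
    taken for \<open>\<xi>\<close>.\<close>
  from Maclaurin[OF _ _ _ this, of "D 0"] obtain s
    where "D 0 1 = (\<Sum>m<2. D m 0 / fact m * 1 ^ m) + D 2 s / fact 2 * 1 ^ 2"
    by auto
  then show thesis
    by (intro that[of "p + s *\<^sub>R v"]) (simp add: D_def v_def numeral_2_eq_2)
qed

lemma loewner_le_quadratic_form:
  assumes "A \<preceq> B"
  shows "x \<bullet> (A *v x) \<le> x \<bullet> (B *v x)"
  using assms unfolding loewner_le_def
  by (simp add: matrix_vector_mult_diff_rdistrib inner_diff_right)

lemma loss_bounds:
  assumes "regular_utility \<T> U \<phi> \<alpha> \<beta>" and "t \<in> \<T>"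
  shows "\<alpha> / 2 * (norm (\<phi> t - a))\<^sup>2 \<le> loss U \<phi> t a"
    and "loss U \<phi> t a \<le> \<beta> / 2 * (norm (\<phi> t - a))\<^sup>2"
proof -
  have twice: "twice_differentiable (U t)" and max: "\<And>a. U t a \<le> U t (\<phi> t)"
    and lower: "\<And>a. (- \<beta>) *\<^sub>R mat 1 \<preceq> hessian (U t) a"
    and upper: "\<And>a. hessian (U t) a \<preceq> (- \<alpha>) *\<^sub>R mat 1"
    using assms unfolding regular_utility_def by auto
  have grad: "gradient (U t) (\<phi> t) = 0"
    using twice max by (simp add: gradient_eq_0_at_max twice_differentiable_def)
  obtain \<xi> where \<xi>: "U t a = U t (\<phi> t) + (a - \<phi> t) \<bullet> gradient (U t) (\<phi> t)
      + (a - \<phi> t) \<bullet> (hessian (U t) \<xi> *v (a - \<phi> t)) / 2"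
    using taylor_second_order[OF twice] by blast
  show "\<alpha> / 2 * (norm (\<phi> t - a))\<^sup>2 \<le> loss U \<phi> t a"
    and "loss U \<phi> t a \<le> \<beta> / 2 * (norm (\<phi> t - a))\<^sup>2"
    \<comment> \<open>The gradient term vanishes, so the loss is minus half the Hessian form. The
      sign swaps the roles: \<open>upper\<close> gives the bound with \<alpha> from below,
      \<open>lower\<close> the one with \<beta> from above.\<close>
    using \<xi> grad
      loewner_le_quadratic_form[OF lower[of \<xi>], of "a - \<phi> t",
        folded scaleR_matrix_vector_assoc, unfolded matrix_vector_mul_lid]
      loewner_le_quadratic_form[OF upper[of \<xi>], of "a - \<phi> t",
        folded scaleR_matrix_vector_assoc, unfolded matrix_vector_mul_lid]
    by (simp_all add: loss_def norm_minus_commute[of "\<phi> t"] power2_norm_eq_inner)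
qed

text \<open>Here the Hessian is constantly -\<gamma> times the identity, so both Loewner bounds hold
  with the same constant. This reduces the equality case to the general inequalities.\<close>

lemma regular_utility_quadratic:
  fixes U :: "real^'d \<Rightarrow> real^'r \<Rightarrow> real"
  assumes "0 < \<gamma>" and "\<forall>t\<in>\<T>. \<forall>a. U t a = u t - \<gamma> / 2 * (norm (a - \<phi> t))\<^sup>2"
  shows "regular_utility \<T> U \<phi> \<gamma> \<gamma>"
  unfolding regular_utility_def
proof
  fix t assume "t \<in> \<T>"
  then have U: "U t = (\<lambda>a. u t - \<gamma> / 2 * ((a - \<phi> t) \<bullet> (a - \<phi> t)))"
    using assms(2) by (auto simp: power2_norm_eq_inner)
  have gderiv: "GDERIV (U t) a :> (- \<gamma>) *\<^sub>R (a - \<phi> t)" for a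
    unfolding gderiv_def U
    by (auto intro!: derivative_eq_intros simp: fun_eq_iff inner_commute algebra_simps)
  then have grad: "gradient (U t) = (\<lambda>a. (- \<gamma>) *\<^sub>R (a - \<phi> t))"
    using gradient_eqI by blast
  \<comment> \<open>The derivative is written as a matrix product so that \<open>hessian_eqI\<close>
    can read the matrix off.\<close>
  have hderiv: "(gradient (U t) has_derivative (\<lambda>h. ((- \<gamma>) *\<^sub>R mat 1) *v h)) (at a)" for a
    unfolding grad scaleR_matrix_vector_assoc[symmetric] matrix_vector_mul_lid
    by (auto intro!: derivative_eq_intros)
  have "twice_differentiable (U t)"
    using gderiv hderiv unfolding twice_differentiable_def gderiv_def differentiable_def by blast
  moreover have "U t a \<le> U t (\<phi> t)" for a
    using \<open>0 < \<gamma>\<close> unfolding U by simp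
  moreover have "hessian (U t) a = (- \<gamma>) *\<^sub>R mat 1" for a
    using hderiv by (rule hessian_eqI)
  ultimately show "twice_differentiable (U t) \<and> (\<forall>a. U t a \<le> U t (\<phi> t))
      \<and> (\<forall>a. (- \<gamma>) *\<^sub>R mat 1 \<preceq> hessian (U t) a) \<and> (\<forall>a. hessian (U t) a \<preceq> (- \<gamma>) *\<^sub>R mat 1)"
    by (simp add: loewner_le_def)
qed

theorem proposition1:
  fixes M :: "'w measure"
    and \<T> :: "(real^'d) set"
    and U :: "real^'d \<Rightarrow> real^'r \<Rightarrow> real"
    and \<phi> :: "real^'d \<Rightarrow> real^'r"
    and T :: "'w \<Rightarrow> real^'d"
  assumes "prob_space M"
    and "T \<in> borel_measurable M"
    and "\<And>\<omega>. \<omega> \<in> space M \<Longrightarrow> T \<omega> \<in> \<T>"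
    and "(\<lambda>(t, a). U t a) \<in> borel_measurable (restrict_space borel \<T> \<Otimes>\<^sub>M borel)"
    and "\<phi> \<in> borel_measurable (restrict_space borel \<T>)"
  shows "(\<forall>\<alpha> \<beta>. 0 < \<alpha> \<longrightarrow> \<alpha> \<le> \<beta> \<longrightarrow> regular_utility \<T> U \<phi> \<alpha> \<beta> \<longrightarrow>
          (\<forall>A \<in> borel_measurable M.
             ennreal (\<alpha> / 2) * ext_expectation M (\<lambda>\<omega>. (norm (\<phi> (T \<omega>) - A \<omega>))\<^sup>2)
               \<le> ext_expectation M (\<lambda>\<omega>. loss U \<phi> (T \<omega>) (A \<omega>)) \<and>
             ext_expectation M (\<lambda>\<omega>. loss U \<phi> (T \<omega>) (A \<omega>))
               \<le> ennreal (\<beta> / 2) * ext_expectation M (\<lambda>\<omega>. (norm (\<phi> (T \<omega>) - A \<omega>))\<^sup>2))) \<and>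
         (\<forall>u \<gamma>. 0 < \<gamma> \<longrightarrow> (\<forall>t\<in>\<T>. \<forall>a. U t a = u t - \<gamma> / 2 * (norm (a - \<phi> t))\<^sup>2) \<longrightarrow>
          regular_utility \<T> U \<phi> \<gamma> \<gamma> \<and>
          (\<forall>A \<in> borel_measurable M.
             ennreal (\<gamma> / 2) * ext_expectation M (\<lambda>\<omega>. (norm (\<phi> (T \<omega>) - A \<omega>))\<^sup>2)
               = ext_expectation M (\<lambda>\<omega>. loss U \<phi> (T \<omega>) (A \<omega>)) \<and>
             ext_expectation M (\<lambda>\<omega>. loss U \<phi> (T \<omega>) (A \<omega>))
               = ennreal (\<gamma> / 2) * ext_expectation M (\<lambda>\<omega>. (norm (\<phi> (T \<omega>) - A \<omega>))\<^sup>2)))"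
proof -
  \<comment> \<open>\<open>\<phi>\<close> is assumed measurable only on \<open>\<T>\<close>, so
    \<open>T\<close> must be seen as a map into the restricted space before composing.\<close>
  have "T \<in> M \<rightarrow>\<^sub>M restrict_space borel \<T>"
    using assms(2,3) by (intro measurable_restrict_space2) auto
  then have [measurable]: "(\<lambda>\<omega>. \<phi> (T \<omega>)) \<in> borel_measurable M"
    using assms(5) by (rule measurable_compose)
  \<comment> \<open>With the constant under the integral, the pointwise bounds can be integrated by
    monotonicity. The identity lives in \<open>ennreal\<close>, so an infinite expectation is
    covered.\<close>
  have pull_out: "ennreal c * ext_expectation M (\<lambda>\<omega>. (norm (\<phi> (T \<omega>) - A \<omega>))\<^sup>2)
      = (\<integral>\<^sup>+ \<omega>. ennreal (c * (norm (\<phi> (T \<omega>) - A \<omega>))\<^sup>2) \<partial>M)"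
    if [measurable]: "A \<in> borel_measurable M" and "0 < c" for A c
  proof -
    have "ennreal c * ext_expectation M (\<lambda>\<omega>. (norm (\<phi> (T \<omega>) - A \<omega>))\<^sup>2)
        = (\<integral>\<^sup>+ \<omega>. ennreal c * ennreal ((norm (\<phi> (T \<omega>) - A \<omega>))\<^sup>2) \<partial>M)"
      unfolding ext_expectation_def by (rule nn_integral_cmult[symmetric]) measurable
    then show ?thesis
      using \<open>0 < c\<close> by (simp add: ennreal_mult)
  qed
  have bounds: "ennreal (\<alpha> / 2) * ext_expectation M (\<lambda>\<omega>. (norm (\<phi> (T \<omega>) - A \<omega>))\<^sup>2)
        \<le> ext_expectation M (\<lambda>\<omega>. loss U \<phi> (T \<omega>) (A \<omega>)) \<and>
      ext_expectation M (\<lambda>\<omega>. loss U \<phi> (T \<omega>) (A \<omega>))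
        \<le> ennreal (\<beta> / 2) * ext_expectation M (\<lambda>\<omega>. (norm (\<phi> (T \<omega>) - A \<omega>))\<^sup>2)"
    if "0 < \<alpha>" "\<alpha> \<le> \<beta>" and reg: "regular_utility \<T> U \<phi> \<alpha> \<beta>" and "A \<in> borel_measurable M"
    for \<alpha> \<beta> A
  proof -
    have pos: "0 < \<alpha> / 2" "0 < \<beta> / 2"
      using that by auto
    show ?thesis
      unfolding pull_out[OF that(4) pos(1)] pull_out[OF that(4) pos(2)]
      unfolding ext_expectation_def
      using loss_bounds[OF reg assms(3)] by (intro conjI nn_integral_mono ennreal_leI)
  qed
  show ?thesis
  proof (intro conjI allI impI ballI)
    fix u \<gamma> and A :: "'w \<Rightarrow> real^'r"
    assume \<gamma>: "0 < (\<gamma>::real)" and "\<forall>t\<in>\<T>. \<forall>a. U t a = u t - \<gamma> / 2 * (norm (a - \<phi> t))\<^sup>2"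
    then show reg: "regular_utility \<T> U \<phi> \<gamma> \<gamma>"
      by (rule regular_utility_quadratic)
    assume "A \<in> borel_measurable M"
    \<comment> \<open>For \<alpha> = \<beta> = \<gamma> the two outer terms coincide, and
      antisymmetry turns the sandwich into equalities.\<close>
    note bounds[OF \<gamma> order_refl reg this]
    then show "ennreal (\<gamma> / 2) * ext_expectation M (\<lambda>\<omega>. (norm (\<phi> (T \<omega>) - A \<omega>))\<^sup>2)
        = ext_expectation M (\<lambda>\<omega>. loss U \<phi> (T \<omega>) (A \<omega>))"
      and "ext_expectation M (\<lambda>\<omega>. loss U \<phi> (T \<omega>) (A \<omega>))
        = ennreal (\<gamma> / 2) * ext_expectation M (\<lambda>\<omega>. (norm (\<phi> (T \<omega>) - A \<omega>))\<^sup>2)"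
      by (auto intro: antisym)
  qed (use bounds in blast)+
qed

end
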